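(* Let $d\ge2$ and $p\ge1$ be integers, let $V_1,\dots,V_n$ be linear subspaces of $\mathbb{R}^d$ with $1\le\dim(V_j)\le d-1$ (not necessarily of the same dimension), and let $\omega_1,\dots,\omega_n$ be positive weights. For $1\le k\le d-1$ define $m_k:=\sum_{i:\dim(V_i)=k}\omega_i$, and let $M=(m_1,\dots,m_{d-1})$ (a row vector). Then $$\sum_{i,j=1}^n\omega_i\omega_j\langle P_{V_i},P_{V_j}\rangle^p\;\ge\; M\,T_d(p)\,M^{\top}.$$
   Context: $P_V$ denotes the orthogonal projection of $\mathbb{R}^d$ onto the subspace $V$, and $\langle P,Q\rangle:=\operatorname{trace}(PQ)$. $\mathcal{G}_{k,d}$ is the real Grassmann space of $k$-dimensional subspaces of $\mathbb{R}^d$, with $O(\mathbb{R}^d)$-invariant probability measure $\sigma_k$. For $1\le k,l\le d-1$, $$T_{k,l,d}(p):=\int_{\mathcal{G}_{k,d}}\int_{\mathcal{G}_{l,d}}\langle P_V,P_W\rangle^p\,d\sigma_k(V)\,d\sigma_l(W)$$ (with $V\in\mathcal{G}_{k,d}$, $W\in\mathcal{G}_{l,d}$), and $T_d(p):=\big(T_{k,l,d}(p)\big)_{1\le k,l\le d-1}$ is the corresponding $(d-1)\times(d-1)$ matrix. *)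

theory Defs
  imports "HOL-Analysis.Analysis" "HOL-Probability.Probability_Measure"
begin

definition orth_proj :: "'a::euclidean_space set \<Rightarrow> 'a \<Rightarrow> 'a" where
  "orth_proj V x = (THE y. y \<in> V \<and> x - y \<in> V\<^sup>\<bottom>)"

lemma orth_proj_eqI:
  assumes V: "subspace V" and y: "y \<in> V" "x - y \<in> V\<^sup>\<bottom>"
  shows "orth_proj V x = y"
  unfolding orth_proj_def
proof (rule the_equality)
  show "y \<in> V \<and> x - y \<in> V\<^sup>\<bottom>" using y by simp
  fix z assume z: "z \<in> V \<and> x - z \<in> V\<^sup>\<bottom>"
  have "z - y \<in> V" using V y z by (simp add: subspace_diff)
  moreover have "z - y \<in> V\<^sup>\<bottom>"
  proof -
    have "(x - y) - (x - z) \<in> V\<^sup>\<bottom>"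
      using y z subspace_orthogonal_comp[of V] by (blast intro: subspace_diff)
    then show ?thesis by simp
  qed
  ultimately have "orthogonal (z - y) (z - y)" by (auto simp: orthogonal_comp_def)
  then show "z = y" by (simp add: orthogonal_self)
qed

lemma orth_proj_decomp:
  assumes "subspace V"
  shows "orth_proj V x \<in> V" "x - orth_proj V x \<in> V\<^sup>\<bottom>"
proof -
  obtain y z where y: "y \<in> span V" and z: "\<And>w. w \<in> span V \<Longrightarrow> orthogonal z w" and x: "x = y + z"
    using orthogonal_subspace_decomp_exists by blast
  have sp: "span V = V" using assms by (simp add: span_eq_iff)
  have "y \<in> V" "x - y \<in> V\<^sup>\<bottom>"
    using y z x sp by (auto simp: orthogonal_comp_def orthogonal_commute)
  moreover from this have "orth_proj V x = y" by (rule orth_proj_eqI[OF assms])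
  ultimately show "orth_proj V x \<in> V" "x - orth_proj V x \<in> V\<^sup>\<bottom>" by simp_all
qed

lemma linear_orth_proj:
  assumes V: "subspace V"
  shows "linear (orth_proj V)"
proof (rule linearI)
  note d = orth_proj_decomp[OF V] and c = subspace_orthogonal_comp[of V]
  fix x y
  have "x + y - (orth_proj V x + orth_proj V y) = (x - orth_proj V x) + (y - orth_proj V y)"
    by simp
  then show "orth_proj V (x + y) = orth_proj V x + orth_proj V y"
    using subspace_add[OF c d(2) d(2)] d(1) V by (intro orth_proj_eqI) (auto simp only: subspace_add)
next
  note d = orth_proj_decomp[OF V] and c = subspace_orthogonal_comp[of V]
  fix r x
  have "r *\<^sub>R x - r *\<^sub>R orth_proj V x = r *\<^sub>R (x - orth_proj V x)"
    by (simp add: scaleR_diff_right)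
  then show "orth_proj V (r *\<^sub>R x) = r *\<^sub>R orth_proj V x"
    using subspace_scale[OF c d(2)] d(1) V by (intro orth_proj_eqI) (auto simp only: subspace_scale)
qed

definition proj_matrix :: "(real^'n) set \<Rightarrow> real^'n^'n" where
  "proj_matrix V = matrix (orth_proj V)"

definition trace_inner :: "real^'n^'n \<Rightarrow> real^'n^'n \<Rightarrow> real" where
  "trace_inner P Q = trace (P ** Q)"

definition grassmannian :: "nat \<Rightarrow> (real^'n) set set" where
  "grassmannian k = {V. subspace V \<and> dim V = k}"

text \<open>The Grassmannian carries the topology making \<open>V \<mapsto> P\<^sub>V\<close> an embedding into the
  space of matrices; its Borel sets are then exactly the preimages of Borel sets of matrices.\<close>

definition grassmann_borel :: "nat \<Rightarrow> (real^'n) set measure" where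
  "grassmann_borel k = vimage_algebra (grassmannian k) proj_matrix borel"

lemma space_grassmann_borel [simp]: "space (grassmann_borel k) = grassmannian k"
  by (simp add: grassmann_borel_def)

lemma measurable_proj_matrix [measurable]: "proj_matrix \<in> borel_measurable (grassmann_borel k)"
  unfolding grassmann_borel_def by (rule measurable_vimage_algebra1) simp

lemma proj_matrix_image:
  fixes f :: "real^'n \<Rightarrow> real^'n"
  assumes V: "subspace V" and f: "orthogonal_transformation f"
  shows "proj_matrix (f ` V) = matrix f ** proj_matrix V ** transpose (matrix f)"
proof -
  note lf = orthogonal_transformation_linear[OF f]
  have mw: "matrix g *v x = g x" if "linear g" for g :: "real^'n \<Rightarrow> real^'n" and x
    using matrix_vector_mul(2)[OF that] by metis
  have om: "orthogonal_matrix (matrix f)"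
    using f by (simp add: orthogonal_transformation_matrix)
  have adj: "f (transpose (matrix f) *v x) = x" for x
    using om by (simp only: orthogonal_matrix_def matrix_vector_mul_assoc mw[OF lf, symmetric] matrix_vector_mul_lid)
  have sV: "subspace (f ` V)" using V lf by (rule linear_subspace_image[rotated])
  have "orth_proj (f ` V) x = (matrix f ** proj_matrix V ** transpose (matrix f)) *v x" for x
  proof -
    let ?z = "transpose (matrix f) *v x"
    have e: "(matrix f ** proj_matrix V ** transpose (matrix f)) *v x = f (orth_proj V ?z)"
      by (simp only: proj_matrix_def matrix_vector_mul_assoc[symmetric] mw[OF lf]
            mw[OF linear_orth_proj[OF V]])
    have d: "x - f (orth_proj V ?z) = f (?z - orth_proj V ?z)"
      using adj lf by (simp add: linear_diff)
    show ?thesis unfolding e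
    proof (rule orth_proj_eqI[OF sV])
      show "f (orth_proj V ?z) \<in> f ` V" using orth_proj_decomp[OF V] by blast
      show "x - f (orth_proj V ?z) \<in> (f ` V)\<^sup>\<bottom>"
        unfolding d using orth_proj_decomp(2)[OF V, of ?z] f
        by (auto simp: orthogonal_comp_def orthogonal_def orthogonal_transformation_def)
    qed
  qed
  then have "orth_proj (f ` V) = (*v) (matrix f ** proj_matrix V ** transpose (matrix f))"
    by (rule ext)
  then show ?thesis by (simp add: proj_matrix_def)
qed

lemma measurable_grassmann_image:
  fixes f :: "real^'n \<Rightarrow> real^'n"
  assumes f: "orthogonal_transformation f"
  shows "(`) f \<in> measurable (grassmann_borel k) (grassmann_borel k)"
proof -
  have inj: "inj f" "linear f"
    using f by (simp_all add: orthogonal_transformation_inj orthogonal_transformation_linear)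
  have s: "(`) f \<in> grassmannian k \<rightarrow> grassmannian k"
    using inj by (auto simp: grassmannian_def linear_subspace_image dim_image_eq inj_on_subset)
  have c: "continuous_on UNIV (\<lambda>A::real^'n^'n. matrix f ** A ** transpose (matrix f))"
    unfolding matrix_matrix_mult_def by (intro continuous_intros)
  have "(\<lambda>V. matrix f ** proj_matrix V ** transpose (matrix f)) \<in> borel_measurable (grassmann_borel k)"
    using borel_measurable_continuous_onI[OF c] by measurable
  then have "(\<lambda>V. proj_matrix (f ` V)) \<in> borel_measurable (grassmann_borel k)"
    by (rule measurable_cong[THEN iffD1, rotated])
      (use f in \<open>auto simp: grassmannian_def proj_matrix_image\<close>)
  then show ?thesis
    using s by (subst (2) grassmann_borel_def) (intro measurable_vimage_algebra2, auto)
qed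

text \<open>The \<open>O(\<real>\<^sup>d)\<close>-invariant Borel probability measure on the Grassmannian, as a
  predicate. The orthogonal group acts by \<open>V \<mapsto> f ` V\<close>, which is measurable by
  \<open>measurable_grassmann_image\<close>, so \<open>distr\<close> is a genuine push-forward.\<close>

definition invariant_grassmann_prob :: "nat \<Rightarrow> (real^'n) set measure \<Rightarrow> bool" where
  "invariant_grassmann_prob k \<mu> \<longleftrightarrow>
     prob_space \<mu> \<and> sets \<mu> = sets (grassmann_borel k) \<and>
     (\<forall>f. orthogonal_transformation f \<longrightarrow> distr \<mu> (grassmann_borel k) ((`) f) = \<mu>)"

definition T_entry :: "(nat \<Rightarrow> (real^'n) set measure) \<Rightarrow> nat \<Rightarrow> nat \<Rightarrow> nat \<Rightarrow> real" where
  "T_entry \<sigma> p k l =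
     (LINT V|\<sigma> k. (LINT W|\<sigma> l. trace_inner (proj_matrix V) (proj_matrix W) ^ p))"

definition dim_weight :: "nat \<Rightarrow> (nat \<Rightarrow> (real^'n) set) \<Rightarrow> (nat \<Rightarrow> real) \<Rightarrow> nat \<Rightarrow> real" where
  "dim_weight n V \<omega> k = (\<Sum>i | i \<in> {1..n} \<and> dim (V i) = k. \<omega> i)"

end

theory Submission
  imports Defs
begin

text \<open>
  The kernel \<open>K(V, W) = \<langle>P\<^sub>V, P\<^sub>W\<rangle>\<^sup>p\<close> is positive semidefinite: projection matrices are symmetric, so
  \<open>\<langle>P\<^sub>V, P\<^sub>W\<rangle>\<close> is the entrywise inner product of matrices, and expanding its \<open>p\<close>-th power gives
  \<open>K(V, W) = \<Sum>\<^sub>\<alpha> \<phi>\<^sub>\<alpha>(V) \<phi>\<^sub>\<alpha>(W)\<close>, a finite sum over the degree-\<open>p\<close> monomials \<open>\<phi>\<^sub>\<alpha>\<close> in the matrix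
  entries (\<open>trace_inner_power\<close>).

  The inequality is the statement that the signed measure
  \<open>\<nu> = \<Sum>\<^sub>i \<omega>\<^sub>i \<delta>\<^bsub>V\<^sub>i\<^esub> - \<Sum>\<^sub>k m\<^sub>k \<sigma>\<^sub>k\<close> has nonnegative energy \<open>\<integral>\<integral>K d\<nu> d\<nu>\<close>. The terms pairing a
  point mass with some \<open>\<sigma>\<^sub>l\<close> are controlled by invariance: the potential
  \<open>V \<mapsto> \<integral>K(V, W) d\<sigma>\<^sub>l(W)\<close> is unchanged when \<open>V\<close> is replaced by \<open>f(V)\<close> with \<open>f\<close> orthogonal, and the
  orthogonal group is transitive on subspaces of a given dimension \<open>k\<close>, so the potential is constant
  on them; averaging over \<open>\<sigma>\<^sub>k\<close> identifies the constant as \<open>T\<^sub>k\<^sub>,\<^sub>l\<close> (\<open>potential_eq_T_entry\<close>).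
  Hence both cross terms equal \<open>M T M\<^sup>T\<close>, the energy of \<open>\<nu>\<close> is
  \<open>\<Sum>\<^sub>i\<^sub>j \<omega>\<^sub>i \<omega>\<^sub>j K(V\<^sub>i, V\<^sub>j) - 2 M T M\<^sup>T + M T M\<^sup>T\<close>, and its nonnegativity is the claim. Because the
  expansion into monomials is finite, every double integral splits into products of single integrals,
  and the energy is literally a sum of squares.
\<close>

section \<open>Transitivity of the orthogonal group on subspaces of equal dimension\<close>

lemma dim_orthogonal_comp_add:
  fixes V :: "'a::euclidean_space set"
  assumes "subspace V"
  shows "dim (V\<^sup>\<bottom>) + dim V = DIM('a)"
  using dim_subspace_orthogonal_to_vectors[OF assms subspace_UNIV]
  by (simp add: orthogonal_comp_def)

text \<open>An isometry \<open>V \<rightarrow> W\<close> and an isometry of the orthogonal complements, which have equal dimension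
  as well, glue to an isometry of the whole space by Pythagoras.\<close>

lemma orthogonal_transformation_between_subspaces:
  fixes V W :: "'a::euclidean_space set"
  assumes V: "subspace V" and W: "subspace W" and dim: "dim V = dim W"
  obtains f where "orthogonal_transformation f" "f ` V = W"
proof -
  have dim': "dim (V\<^sup>\<bottom>) = dim (W\<^sup>\<bottom>)"
    using dim_orthogonal_comp_add[OF V] dim_orthogonal_comp_add[OF W] dim by simp
  obtain g where g: "linear g" "g ` V = W" "\<And>x. x \<in> V \<Longrightarrow> norm (g x) = norm x"
    using isometry_subspaces[OF V W dim] by metis
  obtain h where h: "linear h" "h ` (V\<^sup>\<bottom>) = W\<^sup>\<bottom>" "\<And>x. x \<in> V\<^sup>\<bottom> \<Longrightarrow> norm (h x) = norm x"
    using isometry_subspaces[OF subspace_orthogonal_comp subspace_orthogonal_comp dim'] by metis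
  define f where "f x = g (orth_proj V x) + h (x - orth_proj V x)" for x
  note P = orth_proj_decomp[OF V]
  have lin: "linear f"
    unfolding f_def
    by (intro linear_compose_add linear_compose[OF _ g(1), unfolded o_def]
        linear_compose[OF _ h(1), unfolded o_def] linear_compose_sub linear_orth_proj[OF V] linear_ident)
  have "norm (f x) = norm x" for x
  proof -
    have "g (orth_proj V x) \<in> W" "h (x - orth_proj V x) \<in> W\<^sup>\<bottom>"
      using g(2) h(2) P by blast+
    then have "orthogonal (g (orth_proj V x)) (h (x - orth_proj V x))"
      by (simp add: orthogonal_comp_def)
    then have "norm (f x) ^ 2 = norm (g (orth_proj V x)) ^ 2 + norm (h (x - orth_proj V x)) ^ 2"
      unfolding f_def by (rule norm_add_Pythagorean)
    also have "\<dots> = norm (orth_proj V x) ^ 2 + norm (x - orth_proj V x) ^ 2"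
      using g(3) h(3) P by simp
    also have "\<dots> = norm (orth_proj V x + (x - orth_proj V x)) ^ 2"
      using P by (intro norm_add_Pythagorean[symmetric]) (auto simp: orthogonal_comp_def)
    finally show ?thesis by simp
  qed
  then have f: "orthogonal_transformation f"
    using lin by (simp add: orthogonal_transformation)
  have "f x = g x" if "x \<in> V" for x
  proof -
    have "orth_proj V x = x"
      using that subspace_0[OF subspace_orthogonal_comp] by (intro orth_proj_eqI[OF V]) auto
    then show ?thesis
      using linear_0[OF h(1)] by (simp add: f_def)
  qed
  then have "f ` V = W" using g(2) by auto
  with f show thesis by (rule that)
qed

section \<open>Projection matrices\<close>

lemma orth_proj_self_adjoint:
  assumes V: "subspace V"
  shows "orth_proj V x \<bullet> y = x \<bullet> orth_proj V y"
proof -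
  note P = orth_proj_decomp[OF V]
  have "orth_proj V x \<bullet> (y - orth_proj V y) = 0" "orth_proj V y \<bullet> (x - orth_proj V x) = 0"
    using P by (auto simp: orthogonal_comp_def orthogonal_def)
  then show ?thesis by (simp add: inner_diff_right inner_commute)
qed

lemma norm_orth_proj_le:
  assumes V: "subspace V"
  shows "norm (orth_proj V x) \<le> norm x"
proof -
  have "norm (orth_proj V x + (x - orth_proj V x)) ^ 2
      = norm (orth_proj V x) ^ 2 + norm (x - orth_proj V x) ^ 2"
    using orth_proj_decomp[OF V] by (intro norm_add_Pythagorean) (auto simp: orthogonal_comp_def)
  then have "norm (orth_proj V x) ^ 2 \<le> norm x ^ 2" by simp
  then show ?thesis by (rule power2_le_imp_le) simp
qed

lemma proj_matrix_entry: "proj_matrix V $ i $ j = orth_proj V (axis j 1) \<bullet> axis i 1"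
  by (simp add: proj_matrix_def matrix_def inner_axis)

lemma proj_matrix_symmetric:
  assumes "subspace V"
  shows "proj_matrix V $ i $ j = proj_matrix V $ j $ i"
  unfolding proj_matrix_entry using orth_proj_self_adjoint[OF assms] by (metis inner_commute)

lemma abs_proj_matrix_entry_le:
  assumes "subspace V"
  shows "\<bar>proj_matrix V $ i $ j\<bar> \<le> 1"
proof -
  have "\<bar>proj_matrix V $ i $ j\<bar> \<le> norm (orth_proj V (axis j 1))"
    unfolding proj_matrix_def matrix_def by (simp add: component_le_norm_cart)
  also have "\<dots> \<le> 1"
    using norm_orth_proj_le[OF assms, of "axis j 1"] by simp
  finally show ?thesis .
qed

lemma trace_inner_orthogonal_image:
  fixes f :: "real^'n \<Rightarrow> real^'n"
  assumes V: "subspace V" and W: "subspace W" and f: "orthogonal_transformation f"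
  shows "trace_inner (proj_matrix (f ` V)) (proj_matrix (f ` W))
       = trace_inner (proj_matrix V) (proj_matrix W)"
proof -
  let ?A = "matrix f" and ?P = "proj_matrix V" and ?Q = "proj_matrix W"
  have A: "transpose ?A ** ?A = mat 1"
    using f by (simp add: orthogonal_transformation_matrix orthogonal_matrix)
  have "(?A ** ?P ** transpose ?A) ** (?A ** ?Q ** transpose ?A)
      = ?A ** (?P ** (transpose ?A ** ?A) ** ?Q ** transpose ?A)"
    by (simp only: matrix_mul_assoc)
  also have "\<dots> = ?A ** (?P ** ?Q ** transpose ?A)"
    by (simp only: A matrix_mul_rid)
  finally have "trace ((?A ** ?P ** transpose ?A) ** (?A ** ?Q ** transpose ?A))
      = trace (?A ** (?P ** ?Q ** transpose ?A))"
    by (rule arg_cong)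
  also have "\<dots> = trace ((?P ** ?Q ** transpose ?A) ** ?A)"
    by (rule trace_mul_sym)
  also have "\<dots> = trace (?P ** ?Q ** (transpose ?A ** ?A))"
    by (simp only: matrix_mul_assoc)
  also have "\<dots> = trace (?P ** ?Q)"
    by (simp only: A matrix_mul_rid)
  finally show ?thesis
    by (simp only: trace_inner_def proj_matrix_image[OF V f] proj_matrix_image[OF W f])
qed

section \<open>The kernel as a finite sum of products of monomials\<close>

text \<open>A monomial is indexed by the sequence \<open>\<alpha>\<close> of the \<open>p\<close> matrix positions whose entries are
  multiplied; the monomials are the coordinates of the \<open>p\<close>-fold tensor power of the matrix.\<close>

definition proj_monomial :: "nat \<Rightarrow> (nat \<Rightarrow> 'n \<times> 'n) \<Rightarrow> (real^'n) set \<Rightarrow> real" where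
  "proj_monomial p \<alpha> V = (\<Prod>s<p. proj_matrix V $ fst (\<alpha> s) $ snd (\<alpha> s))"

definition positions :: "nat \<Rightarrow> (nat \<Rightarrow> 'n::finite \<times> 'n) set" where
  "positions p = {..<p} \<rightarrow>\<^sub>E UNIV"

lemma trace_inner_power:
  fixes V W :: "(real^'n) set"
  assumes W: "subspace W"
  shows "trace_inner (proj_matrix V) (proj_matrix W) ^ p
       = (\<Sum>\<alpha>\<in>positions p. proj_monomial p \<alpha> V * proj_monomial p \<alpha> W)"
proof -
  let ?e = "\<lambda>c. proj_matrix V $ fst c $ snd c * proj_matrix W $ fst c $ snd c"
  have "trace_inner (proj_matrix V) (proj_matrix W)
      = (\<Sum>i\<in>UNIV. \<Sum>j\<in>UNIV. proj_matrix V $ i $ j * proj_matrix W $ j $ i)"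
    by (simp add: trace_inner_def trace_def matrix_matrix_mult_def)
  also have "\<dots> = (\<Sum>i\<in>UNIV. \<Sum>j\<in>UNIV. proj_matrix V $ i $ j * proj_matrix W $ i $ j)"
    by (intro sum.cong refl) (simp add: proj_matrix_symmetric[OF W])
  also have "\<dots> = (\<Sum>c\<in>UNIV. ?e c)"
    by (simp add: sum.cartesian_product case_prod_unfold)
  finally have "trace_inner (proj_matrix V) (proj_matrix W) ^ p = (\<Prod>s<p. \<Sum>c\<in>UNIV. ?e c)"
    by simp
  also have "\<dots> = (\<Sum>\<alpha>\<in>positions p. \<Prod>s<p. ?e (\<alpha> s))"
    unfolding positions_def by (rule prod_sum_PiE) simp_all
  finally show ?thesis
    by (simp add: proj_monomial_def prod.distrib)
qed

lemma abs_proj_monomial_le: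
  assumes "subspace V"
  shows "\<bar>proj_monomial p \<alpha> V\<bar> \<le> 1"
  unfolding proj_monomial_def abs_prod
  by (intro prod_le_1) (simp add: abs_proj_matrix_entry_le[OF assms])

section \<open>Integration against the invariant measures\<close>

lemma space_invariant_grassmann_prob:
  assumes "invariant_grassmann_prob k \<mu>"
  shows "space \<mu> = grassmannian k"
  using assms sets_eq_imp_space_eq[of \<mu> "grassmann_borel k"]
  by (simp add: invariant_grassmann_prob_def)

lemma measurable_proj_monomial:
  "proj_monomial p \<alpha> \<in> borel_measurable (grassmann_borel k)"
proof -
  have [measurable]: "(\<lambda>A::real^'m^'m. A $ i $ j) \<in> borel_measurable borel"
    for i j :: "'m::finite"
    by (intro borel_measurable_continuous_onI continuous_intros)
  show ?thesis
    unfolding proj_monomial_def by (intro borel_measurable_prod) measurable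
qed

lemma integrable_proj_monomial:
  assumes \<mu>: "invariant_grassmann_prob k \<mu>"
  shows "integrable \<mu> (proj_monomial p \<alpha>)"
proof -
  interpret prob_space \<mu> using \<mu> by (simp add: invariant_grassmann_prob_def)
  have sets: "sets \<mu> = sets (grassmann_borel k)"
    using \<mu> by (simp add: invariant_grassmann_prob_def)
  show ?thesis
  proof (rule integrable_const_bound[where B = 1])
    show "AE V in \<mu>. norm (proj_monomial p \<alpha> V) \<le> 1"
      by (intro AE_I2) (auto simp: space_invariant_grassmann_prob[OF \<mu>] grassmannian_def
          abs_proj_monomial_le)
    show "proj_monomial p \<alpha> \<in> borel_measurable \<mu>"
      using measurable_proj_monomial measurable_cong_sets[OF sets refl] by blast
  qed
qed

lemma potential_expansion:
  assumes \<mu>: "invariant_grassmann_prob l \<mu>"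
  shows "(LINT W|\<mu>. trace_inner (proj_matrix V) (proj_matrix W) ^ p)
       = (\<Sum>\<alpha>\<in>positions p. proj_monomial p \<alpha> V * (LINT W|\<mu>. proj_monomial p \<alpha> W))"
proof -
  have "(LINT W|\<mu>. trace_inner (proj_matrix V) (proj_matrix W) ^ p)
      = (LINT W|\<mu>. (\<Sum>\<alpha>\<in>positions p. proj_monomial p \<alpha> V * proj_monomial p \<alpha> W))"
    by (intro Bochner_Integration.integral_cong refl trace_inner_power)
      (simp add: space_invariant_grassmann_prob[OF \<mu>] grassmannian_def)
  also have "\<dots> = (\<Sum>\<alpha>\<in>positions p. LINT W|\<mu>. proj_monomial p \<alpha> V * proj_monomial p \<alpha> W)"
    by (intro Bochner_Integration.integral_sum integrable_mult_right integrable_proj_monomial[OF \<mu>])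
  finally show ?thesis by simp
qed

lemma T_entry_expansion:
  assumes k: "invariant_grassmann_prob k (\<sigma> k)" and l: "invariant_grassmann_prob l (\<sigma> l)"
  shows "T_entry \<sigma> p k l
       = (\<Sum>\<alpha>\<in>positions p. (LINT V|\<sigma> k. proj_monomial p \<alpha> V) * (LINT W|\<sigma> l. proj_monomial p \<alpha> W))"
  unfolding T_entry_def potential_expansion[OF l]
  by (subst Bochner_Integration.integral_sum)
    (auto intro!: integrable_mult_left integrable_proj_monomial[OF k])

lemma potential_orthogonal_invariant:
  fixes f :: "real^'n \<Rightarrow> real^'n"
  assumes \<mu>: "invariant_grassmann_prob l \<mu>" and V: "subspace V"
    and f: "orthogonal_transformation f"
  shows "(LINT W|\<mu>. trace_inner (proj_matrix (f ` V)) (proj_matrix W) ^ p)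
       = (LINT W|\<mu>. trace_inner (proj_matrix V) (proj_matrix W) ^ p)"
proof -
  let ?K = "\<lambda>V W. trace_inner (proj_matrix V) (proj_matrix W) ^ p"
  have sets: "sets \<mu> = sets (grassmann_borel l)" and inv: "distr \<mu> (grassmann_borel l) ((`) f) = \<mu>"
    using \<mu> f by (simp_all add: invariant_grassmann_prob_def)
  have f_meas: "(`) f \<in> measurable \<mu> (grassmann_borel l)"
    using measurable_grassmann_image[OF f] measurable_cong_sets[OF sets refl] by blast
  have "(\<lambda>W. \<Sum>\<alpha>\<in>positions p. proj_monomial p \<alpha> (f ` V) * proj_monomial p \<alpha> W)
      \<in> borel_measurable (grassmann_borel l)"
    by (intro borel_measurable_sum borel_measurable_times measurable_proj_monomial) simp
  then have K_meas: "?K (f ` V) \<in> borel_measurable (grassmann_borel l)"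
    by (rule measurable_cong[THEN iffD1, rotated]) (auto simp: grassmannian_def trace_inner_power)
  have "(LINT W|\<mu>. ?K (f ` V) W) = (LINT W|distr \<mu> (grassmann_borel l) ((`) f). ?K (f ` V) W)"
    by (simp add: inv)
  also have "\<dots> = (LINT W|\<mu>. ?K (f ` V) (f ` W))"
    by (rule integral_distr[OF f_meas K_meas])
  also have "\<dots> = (LINT W|\<mu>. ?K V W)"
    by (intro Bochner_Integration.integral_cong refl arg_cong[where f = "\<lambda>t. t ^ p"]
        trace_inner_orthogonal_image V f)
      (simp add: space_invariant_grassmann_prob[OF \<mu>] grassmannian_def)
  finally show ?thesis .
qed

text \<open>By transitivity the potential of \<open>\<sigma>\<^sub>l\<close> takes at every \<open>k\<close>-dimensional subspace the same value as
  at \<open>V\<close>; since \<open>\<sigma>\<^sub>k\<close> has total mass one, averaging over \<open>\<sigma>\<^sub>k\<close> returns that value.\<close>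

lemma potential_eq_T_entry:
  assumes k: "invariant_grassmann_prob (dim V) (\<sigma> (dim V))"
    and l: "invariant_grassmann_prob l (\<sigma> l)"
    and V: "subspace V"
  shows "(LINT W|\<sigma> l. trace_inner (proj_matrix V) (proj_matrix W) ^ p) = T_entry \<sigma> p (dim V) l"
proof -
  interpret prob_space "\<sigma> (dim V)" using k by (simp add: invariant_grassmann_prob_def)
  let ?g = "\<lambda>U. LINT W|\<sigma> l. trace_inner (proj_matrix U) (proj_matrix W) ^ p"
  have "?g U = ?g V" if "U \<in> space (\<sigma> (dim V))" for U
  proof -
    have "subspace U" "dim V = dim U"
      using that by (auto simp: space_invariant_grassmann_prob[OF k] grassmannian_def)
    then obtain f where f: "orthogonal_transformation f" "f ` V = U"
      using orthogonal_transformation_between_subspaces[OF V] by blast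
    show ?thesis
      using potential_orthogonal_invariant[OF l V f(1)] f(2) by simp
  qed
  then have "T_entry \<sigma> p (dim V) l = (LINT U|\<sigma> (dim V). ?g V)"
    unfolding T_entry_def by (rule Bochner_Integration.integral_cong[OF refl])
  then show ?thesis by (simp add: prob_space)
qed

section \<open>Nonnegativity of the energy\<close>

lemma sum_weight_by_dim:
  assumes "\<And>j. j \<in> {1..n} \<Longrightarrow> 1 \<le> dim (V j) \<and> dim (V j) \<le> N"
  shows "(\<Sum>i=1..n. \<omega> i * h (dim (V i))) = (\<Sum>k=1..N. dim_weight n V \<omega> k * h k)"
proof -
  have "(\<Sum>k=1..N. dim_weight n V \<omega> k * h k)
      = (\<Sum>k=1..N. \<Sum>i\<in>{i \<in> {1..n}. dim (V i) = k}. \<omega> i * h (dim (V i)))"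
    by (simp add: dim_weight_def sum_distrib_right)
  also have "\<dots> = (\<Sum>i=1..n. \<omega> i * h (dim (V i)))"
    using assms by (intro sum.group) auto
  finally show ?thesis by simp
qed

theorem theorem7p1:
  fixes \<sigma> :: "nat \<Rightarrow> (real^'n) set measure"
    and V :: "nat \<Rightarrow> (real^'n) set"
    and \<omega> :: "nat \<Rightarrow> real"
    and n p :: nat
  assumes "CARD('n) \<ge> 2"
    and "p \<ge> 1"
    and "\<And>k. k \<in> {1..CARD('n) - 1} \<Longrightarrow> invariant_grassmann_prob k (\<sigma> k)"
    and "\<And>j. j \<in> {1..n} \<Longrightarrow> subspace (V j)"
    and "\<And>j. j \<in> {1..n} \<Longrightarrow> 1 \<le> dim (V j) \<and> dim (V j) \<le> CARD('n) - 1"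
    and "\<And>j. j \<in> {1..n} \<Longrightarrow> \<omega> j > 0"
  shows "(\<Sum>i=1..n. \<Sum>j=1..n.
            \<omega> i * \<omega> j * trace_inner (proj_matrix (V i)) (proj_matrix (V j)) ^ p)
         \<ge> (\<Sum>k=1..CARD('n) - 1. \<Sum>l=1..CARD('n) - 1.
              dim_weight n V \<omega> k * T_entry \<sigma> p k l * dim_weight n V \<omega> l)"
proof -
  note inv = assms(3) and sub = assms(4) and dims = assms(5)
  let ?N = "CARD('n) - 1" and ?A = "positions p :: (nat \<Rightarrow> 'n \<times> 'n) set"
  define m where "m = dim_weight n V \<omega>"
  define a where "a \<alpha> k = (LINT W|\<sigma> k. proj_monomial p \<alpha> W)" for \<alpha> k
  \<comment> \<open>The \<open>\<alpha>\<close>-th moments of the discrete measure and of the mixture of invariant measures.\<close>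
  define s where "s \<alpha> = (\<Sum>i=1..n. \<omega> i * proj_monomial p \<alpha> (V i))" for \<alpha>
  define b where "b \<alpha> = (\<Sum>l=1..?N. m l * a \<alpha> l)" for \<alpha>
  let ?S = "\<Sum>i=1..n. \<Sum>j=1..n. \<omega> i * \<omega> j * trace_inner (proj_matrix (V i)) (proj_matrix (V j)) ^ p"
  let ?MTM = "\<Sum>k=1..?N. \<Sum>l=1..?N. m k * T_entry \<sigma> p k l * m l"
  have discrete: "(\<Sum>\<alpha>\<in>?A. s \<alpha> * s \<alpha>) = ?S"
  proof -
    have "?S = (\<Sum>i=1..n. \<Sum>j=1..n. \<Sum>\<alpha>\<in>?A.
        (\<omega> i * proj_monomial p \<alpha> (V i)) * (\<omega> j * proj_monomial p \<alpha> (V j)))"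
      by (intro sum.cong refl) (simp add: trace_inner_power sub sum_distrib_left mult_ac)
    also have "\<dots> = (\<Sum>\<alpha>\<in>?A. \<Sum>i=1..n. \<Sum>j=1..n.
        (\<omega> i * proj_monomial p \<alpha> (V i)) * (\<omega> j * proj_monomial p \<alpha> (V j)))"
      by (simp only: sum.swap[where B = ?A])
    finally show ?thesis
      by (simp add: s_def sum_product)
  qed
  have continuous: "(\<Sum>\<alpha>\<in>?A. b \<alpha> * b \<alpha>) = ?MTM"
  proof -
    have "?MTM = (\<Sum>k=1..?N. \<Sum>l=1..?N. \<Sum>\<alpha>\<in>?A. (m k * a \<alpha> k) * (m l * a \<alpha> l))"
      by (intro sum.cong refl)
        (simp add: T_entry_expansion inv a_def sum_distrib_left sum_distrib_right mult_ac)
    also have "\<dots> = (\<Sum>\<alpha>\<in>?A. \<Sum>k=1..?N. \<Sum>l=1..?N. (m k * a \<alpha> k) * (m l * a \<alpha> l))"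
      by (simp only: sum.swap[where B = ?A])
    finally show ?thesis
      by (simp add: b_def sum_product)
  qed
  have cross: "(\<Sum>\<alpha>\<in>?A. s \<alpha> * b \<alpha>) = ?MTM"
  proof -
    have pot: "(\<Sum>\<alpha>\<in>?A. proj_monomial p \<alpha> (V i) * a \<alpha> l) = T_entry \<sigma> p (dim (V i)) l"
      if "i \<in> {1..n}" "l \<in> {1..?N}" for i l
    proof -
      have "dim (V i) \<in> {1..?N}"
        using dims[OF that(1)] by simp
      then show ?thesis
        using potential_eq_T_entry[OF inv inv[OF that(2)] sub[OF that(1)], of p]
          potential_expansion[OF inv[OF that(2)], of "V i" p]
        by (simp add: a_def)
    qed
    have "(\<Sum>\<alpha>\<in>?A. s \<alpha> * b \<alpha>)
        = (\<Sum>\<alpha>\<in>?A. \<Sum>i=1..n. \<Sum>l=1..?N. (\<omega> i * proj_monomial p \<alpha> (V i)) * (m l * a \<alpha> l))"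
      by (simp add: s_def b_def sum_product)
    also have "\<dots> = (\<Sum>i=1..n. \<Sum>l=1..?N. \<Sum>\<alpha>\<in>?A. (\<omega> i * proj_monomial p \<alpha> (V i)) * (m l * a \<alpha> l))"
      by (simp only: sum.swap[where B = ?A])
    also have "\<dots> = (\<Sum>i=1..n. \<omega> i * (\<Sum>l=1..?N. T_entry \<sigma> p (dim (V i)) l * m l))"
      by (intro sum.cong refl)
        (simp add: pot[symmetric] sum_distrib_left sum_distrib_right mult_ac)
    also have "\<dots> = (\<Sum>k=1..?N. m k * (\<Sum>l=1..?N. T_entry \<sigma> p k l * m l))"
      unfolding m_def by (rule sum_weight_by_dim) (rule dims)
    finally show ?thesis
      by (simp add: sum_distrib_left mult.assoc)
  qed
  have "0 \<le> (\<Sum>\<alpha>\<in>?A. (s \<alpha> - b \<alpha>)\<^sup>2)"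
    by (intro sum_nonneg) simp
  also have "\<dots> = (\<Sum>\<alpha>\<in>?A. s \<alpha> * s \<alpha>) - 2 * (\<Sum>\<alpha>\<in>?A. s \<alpha> * b \<alpha>) + (\<Sum>\<alpha>\<in>?A. b \<alpha> * b \<alpha>)"
    by (simp add: power2_eq_square algebra_simps sum.distrib sum_subtractf sum_distrib_left)
  finally have "?MTM \<le> ?S"
    unfolding discrete continuous cross by simp
  then show ?thesis
    unfolding m_def .
qed

end
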